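(* Let $N=2$, let $F$ satisfy (A1), (A2) and (A4), and assume $F''(1)\ne3$. Let $E_{min}(q)=\inf\{\int_{\mathbb R^2}|\nabla\psi|^2dx+\int_{\mathbb R^2}|V(|\psi|^2)|dx:\psi\in\mathcal E,\ Q(\psi)=q\}$. Then $E_{min}(q)<v_sq$ for every $q>0$.
   Context: $F:[0,\infty)\to\mathbb R$, $V(s)=\int_s^1F$. (A1) $F$ continuous, $C^1$ near $1$, $F(1)=0$, $F'(1)=-1$ (paper's normalization). (A2) $|F(s)|\le C(1+s^{p_0})$ for some $C>0$, $p_0<\infty$. (A4) $F$ is $C^2$ near $1$ and $F(s)=-(s-1)+\frac12F''(1)(s-1)^2+O((s-1)^3)$ as $s\to1$. $v_s=\sqrt2$. Fix odd $\varphi\in C^\infty(\mathbb R)$, $\varphi(s)=s$ on $[0,2]$, $0\le\varphi'\le1$, $\varphi=3$ on $[4,\infty)$; $\mathcal E=\{\psi\in L^1_{loc}(\mathbb R^2;\mathbb C):\nabla\psi\in L^2,\varphi^2(|\psi|)-1\in L^2\}$. Momentum: $\mathcal Y=\{\partial_{x_1}\phi:\phi\in L^1_{loc},\nabla\phi\in L^2\}$, $L(v+w)=\int v$ ($v\in L^1$, $w\in\mathcal Y$), $Q(\psi)=L(\langle i\partial_{x_1}\psi,\psi\rangle)$, $\langle z_1,z_2\rangle=\mathrm{Re}(z_1\bar z_2)$. *)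

theory Defs
  imports "HOL-Analysis.Analysis"
begin

definition Vpot :: "(real \<Rightarrow> real) \<Rightarrow> real \<Rightarrow> real" where
  "Vpot F s = (if s \<le> 1 then integral {s..1} F else - integral {1..s} F)"

definition test_fun ::
  "(real \<times> real \<Rightarrow> real) \<Rightarrow> (real \<times> real \<Rightarrow> real) \<Rightarrow> (real \<times> real \<Rightarrow> real) \<Rightarrow> bool" where
  "test_fun \<phi> d1 d2 \<longleftrightarrow>
     (\<forall>x. (\<phi> has_derivative (\<lambda>h. fst h * d1 x + snd h * d2 x)) (at x)) \<and>
     continuous_on UNIV d1 \<and> continuous_on UNIV d2 \<and> bounded {x. \<phi> x \<noteq> 0}"

definition loc_int :: "(real \<times> real \<Rightarrow> 'a::{banach,second_countable_topology}) \<Rightarrow> bool" where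
  "loc_int f \<longleftrightarrow> f \<in> borel_measurable lborel \<and> (\<forall>K. compact K \<longrightarrow> set_integrable lborel K f)"

definition square_int :: "(real \<times> real \<Rightarrow> 'a::{banach,second_countable_topology}) \<Rightarrow> bool" where
  "square_int g \<longleftrightarrow> g \<in> borel_measurable lborel \<and> integrable lborel (\<lambda>x. (norm (g x))\<^sup>2)"

definition weak_grad ::
  "(real \<times> real \<Rightarrow> 'a::{banach,second_countable_topology}) \<Rightarrow> (real \<times> real \<Rightarrow> 'a) \<Rightarrow> (real \<times> real \<Rightarrow> 'a) \<Rightarrow> bool" where
  "weak_grad f g1 g2 \<longleftrightarrow> loc_int f \<and> loc_int g1 \<and> loc_int g2 \<and>
     (\<forall>\<phi> d1 d2. test_fun \<phi> d1 d2 \<longrightarrow>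
        (\<integral>x. d1 x *\<^sub>R f x \<partial>lborel) = - (\<integral>x. \<phi> x *\<^sub>R g1 x \<partial>lborel) \<and>
        (\<integral>x. d2 x *\<^sub>R f x \<partial>lborel) = - (\<integral>x. \<phi> x *\<^sub>R g2 x \<partial>lborel))"

text \<open>Q(psi) = q : <i d_1 psi, psi> = v + d_1 phi with v in L^1, grad phi in L^2, and L(v + d_1 phi) = int v = q.\<close>
definition momentum_is :: "(real \<times> real \<Rightarrow> complex) \<Rightarrow> real \<Rightarrow> bool" where
  "momentum_is \<psi> q \<longleftrightarrow>
     (\<exists>g1 g2 v \<phi> h1 h2. weak_grad \<psi> g1 g2 \<and> square_int g1 \<and> square_int g2 \<and>
        integrable lborel v \<and> weak_grad (\<phi> :: real \<times> real \<Rightarrow> real) h1 h2 \<and>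
        square_int h1 \<and> square_int h2 \<and>
        (AE x in lborel. Re (\<i> * g1 x * cnj (\<psi> x)) = v x + h1 x) \<and>
        (\<integral>x. v x \<partial>lborel) = q)"

definition in_E :: "(real \<Rightarrow> real) \<Rightarrow> (real \<times> real \<Rightarrow> complex) \<Rightarrow> (real \<times> real \<Rightarrow> complex) \<Rightarrow> (real \<times> real \<Rightarrow> complex) \<Rightarrow> bool" where
  "in_E \<kappa> \<psi> g1 g2 \<longleftrightarrow> weak_grad \<psi> g1 g2 \<and> square_int g1 \<and> square_int g2 \<and>
     square_int (\<lambda>x. (\<kappa> (cmod (\<psi> x)))\<^sup>2 - 1)"

definition Emin :: "(real \<Rightarrow> real) \<Rightarrow> (real \<Rightarrow> real) \<Rightarrow> real \<Rightarrow> ennreal" where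
  "Emin F \<kappa> q = Inf {(\<integral>\<^sup>+x. ennreal ((cmod (g1 x))\<^sup>2 + (cmod (g2 x))\<^sup>2) \<partial>lborel)
        + (\<integral>\<^sup>+x. ennreal \<bar>Vpot F ((cmod (\<psi> x))\<^sup>2)\<bar> \<partial>lborel)
      | \<psi> g1 g2. in_E \<kappa> \<psi> g1 g2 \<and> momentum_is \<psi> q}"

end

theory Submission
  imports Defs
begin

text \<open>
  Take trial functions $\psi = \sqrt{1 + r}\, e^{i\theta}$ with $r = -\sqrt 2\, \partial_1\theta$ of compact
  support. Then $\sqrt 2\, Q(\psi) = \int r^2$ exactly, while the energy is at most
  \[ \int r^2 + \frac{3 - F''(1)}{6} \int r^3 + O\Bigl(\int r^4 + |\nabla r|^2 + |\partial_2\theta|^2\Bigr). \]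
  For $r(x,y) = \pm t^3 f'(t^2 x) f(m t^4 y)$, with a bump function $f$ such that $\int f'^3 \neq 0$, the
  quadratic term does not depend on $t$ and is normalised to $\sqrt 2\, q$ by the choice of $m$. The cubic
  term is of order $t^3$, negative for the right sign, and dominates the error for small $t$. Stretching
  in $y$ reaches every $q > 0$ at once, so no gluing of several bumps is needed.
\<close>

section \<open>Continuous functions with compact support\<close>

lemma integrable_continuous_compact_support:
  fixes f :: "'a::euclidean_space \<Rightarrow> 'b::{banach,second_countable_topology}"
  assumes "continuous_on UNIV f" and "compact K" and "\<And>x. x \<notin> K \<Longrightarrow> f x = 0"
  shows "integrable lborel f"
proof -
  have "(\<lambda>x. indicator K x *\<^sub>R f x) = f"
    using assms(3) by (auto simp: fun_eq_iff indicator_def)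
  then show ?thesis
    using borel_integrable_compact[OF assms(2) continuous_on_subset[OF assms(1)]] by simp
qed

lemma loc_int_continuous:
  assumes "continuous_on UNIV f"
  shows "loc_int f"
  unfolding loc_int_def set_integrable_def
  using borel_integrable_compact[OF _ continuous_on_subset[OF assms]]
    borel_measurable_continuous_onI[OF assms] by simp

lemma square_int_continuous_compact_support:
  assumes "continuous_on UNIV f" and "compact K" and "\<And>x. x \<notin> K \<Longrightarrow> f x = 0"
  shows "square_int f"
  unfolding square_int_def
proof
  show "f \<in> borel_measurable lborel"
    using borel_measurable_continuous_onI[OF assms(1)] by simp
  show "integrable lborel (\<lambda>x. (norm (f x))\<^sup>2)"
    by (rule integrable_continuous_compact_support[OF _ assms(2)])
      (use assms(1,3) in \<open>auto intro!: continuous_intros\<close>)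
qed

section \<open>Integration by parts and weak gradients of C^1 functions\<close>

lemma integral_deriv_compact_support:
  fixes u :: "real \<Rightarrow> 'a::euclidean_space"
  assumes "\<And>x. (u has_vector_derivative u' x) (at x)" and "continuous_on UNIV u'"
    and "\<And>x. R \<le> \<bar>x\<bar> \<Longrightarrow> u x = 0" and "\<And>x. R \<le> \<bar>x\<bar> \<Longrightarrow> u' x = 0"
  shows "(\<integral>x. u' x \<partial>lborel) = 0"
proof -
  define T where "T = max R 0"
  have "(\<lambda>x. indicator {-T..T} x *\<^sub>R u' x) = u'"
    using assms(4) by (auto simp: fun_eq_iff indicator_def T_def)
  moreover have "(\<integral>x. indicator {-T..T} x *\<^sub>R u' x \<partial>lborel) = u T - u (-T)"
    using assms(1,2)
    by (intro integral_FTC_Icc) (auto simp: T_def intro: has_vector_derivative_at_within continuous_on_subset)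
  ultimately show ?thesis using assms(3)[of T] assms(3)[of "-T"] by (simp add: T_def)
qed

text \<open>Fubini reduces each claim to the one-dimensional case: every horizontal or vertical
  slice of \<open>u\<close> is a C^1 function that vanishes far out.\<close>

lemma integral_partial_derivs_compact_support:
  fixes u :: "real \<times> real \<Rightarrow> 'a::euclidean_space"
  assumes der: "\<And>z. (u has_derivative (\<lambda>h. fst h *\<^sub>R u1 z + snd h *\<^sub>R u2 z)) (at z)"
    and c1: "continuous_on UNIV u1" and c2: "continuous_on UNIV u2"
    and z: "\<And>z. R \<le> norm z \<Longrightarrow> u z = 0"
      "\<And>z. R \<le> norm z \<Longrightarrow> u1 z = 0" "\<And>z. R \<le> norm z \<Longrightarrow> u2 z = 0"
  shows "(\<integral>z. u1 z \<partial>lborel) = 0" and "(\<integral>z. u2 z \<partial>lborel) = 0"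
proof -
  have n: "\<bar>x\<bar> \<le> norm (x, y)" "\<bar>y\<bar> \<le> norm (x, y)" for x y :: real
    using norm_fst_le[of x y] norm_snd_le[of y x] by auto
  have i: "integrable lborel u1" "integrable lborel u2"
    using c1 c2 z by (auto intro!: integrable_continuous_compact_support[where K="cball 0 R"])
  have d1: "((\<lambda>x. u (x, y)) has_vector_derivative u1 (x, y)) (at x)" for x y
    unfolding has_vector_derivative_def
    by (rule has_derivative_eq_rhs[OF has_derivative_compose[OF _ der]])
      (auto intro!: derivative_eq_intros)
  have d2: "((\<lambda>y. u (x, y)) has_vector_derivative u2 (x, y)) (at y)" for x y
    unfolding has_vector_derivative_def
    by (rule has_derivative_eq_rhs[OF has_derivative_compose[OF _ der]])
      (auto intro!: derivative_eq_intros)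
  have "(\<integral>x. u1 (x, y) \<partial>lborel) = 0" for y
    by (rule integral_deriv_compact_support[OF d1, where R=R])
      (auto intro!: continuous_on_compose2[OF c1] continuous_intros z order_trans[OF _ n(1)])
  then show "(\<integral>z. u1 z \<partial>lborel) = 0"
    using lborel_pair.integral_snd[of "\<lambda>x y. u1 (x, y)"] i by (simp add: lborel_prod)
  have "(\<integral>y. u2 (x, y) \<partial>lborel) = 0" for x
    by (rule integral_deriv_compact_support[OF d2, where R=R])
      (auto intro!: continuous_on_compose2[OF c2] continuous_intros z order_trans[OF _ n(2)])
  then show "(\<integral>z. u2 z \<partial>lborel) = 0"
    using lborel_pair.integral_fst[of "\<lambda>x y. u2 (x, y)"] i by (simp add: lborel_prod)
qed

text \<open>\<open>test_fun\<close> bounds only the set where \<open>\<phi>\<close> is nonzero. Off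
  a large closed ball \<open>\<phi>\<close> is locally zero, so uniqueness of the derivative forces
  both partial derivatives to vanish there too.\<close>

lemma test_fun_compact_support:
  assumes "test_fun \<phi> d1 d2"
  obtains R where "\<And>z. R \<le> norm z \<Longrightarrow> \<phi> z = 0 \<and> d1 z = 0 \<and> d2 z = 0"
proof -
  obtain B where B: "\<And>z. \<phi> z \<noteq> 0 \<Longrightarrow> norm z \<le> B"
    using assms unfolding test_fun_def bounded_iff by auto
  have "\<phi> z = 0 \<and> d1 z = 0 \<and> d2 z = 0" if "B + 1 \<le> norm z" for z
  proof -
    have "((\<lambda>z. 0) has_derivative (\<lambda>h. fst h * d1 z + snd h * d2 z)) (at z)"
    proof (rule has_derivative_transform_within_open)
      show "(\<phi> has_derivative (\<lambda>h. fst h * d1 z + snd h * d2 z)) (at z)"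
        using assms by (simp add: test_fun_def del: split_paired_All)
      show "open (- cball 0 B :: (real \<times> real) set)" by auto
    qed (use that B in force)+
    then have "(\<lambda>h. fst h * d1 z + snd h * d2 z) = (\<lambda>h. 0)"
      by (rule has_derivative_unique) (rule has_derivative_const)
    from fun_cong[OF this, of "(1, 0)"] fun_cong[OF this, of "(0, 1)"]
    show ?thesis using B[of z] that by auto
  qed
  then show thesis using that by blast
qed

text \<open>For a test function the product with \<open>f\<close> is C^1 with bounded support. Its
  partial derivatives therefore integrate to zero, and the product rule turns this into the weak
  identities.\<close>

lemma weak_grad_C1:
  fixes f :: "real \<times> real \<Rightarrow> 'a::euclidean_space"
  assumes der: "\<And>z. (f has_derivative (\<lambda>h. fst h *\<^sub>R g1 z + snd h *\<^sub>R g2 z)) (at z)"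
    and c1: "continuous_on UNIV g1" and c2: "continuous_on UNIV g2"
  shows "weak_grad f g1 g2"
proof -
  have cf: "continuous_on UNIV f"
    using der by (intro has_derivative_continuous_on) (auto intro: has_derivative_at_withinI)
  have "(\<integral>x. d1 x *\<^sub>R f x \<partial>lborel) = - (\<integral>x. \<phi> x *\<^sub>R g1 x \<partial>lborel) \<and>
        (\<integral>x. d2 x *\<^sub>R f x \<partial>lborel) = - (\<integral>x. \<phi> x *\<^sub>R g2 x \<partial>lborel)"
    if T: "test_fun \<phi> d1 d2" for \<phi> d1 d2
  proof -
    obtain R where R: "\<And>z. R \<le> norm z \<Longrightarrow> \<phi> z = 0 \<and> d1 z = 0 \<and> d2 z = 0"
      using test_fun_compact_support[OF T] by blast
    have dp: "(\<phi> has_derivative (\<lambda>h. fst h * d1 z + snd h * d2 z)) (at z)" for z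
      using T by (simp add: test_fun_def del: split_paired_All)
    have cp: "continuous_on UNIV \<phi>" "continuous_on UNIV d1" "continuous_on UNIV d2"
      using T dp by (auto simp: test_fun_def intro!: has_derivative_continuous_on
          intro: has_derivative_at_withinI)
    have I: "integrable lborel (\<lambda>x. d1 x *\<^sub>R f x)" "integrable lborel (\<lambda>x. \<phi> x *\<^sub>R g1 x)"
      "integrable lborel (\<lambda>x. d2 x *\<^sub>R f x)" "integrable lborel (\<lambda>x. \<phi> x *\<^sub>R g2 x)"
      using R by (auto intro!: integrable_continuous_compact_support[where K="cball 0 R"]
          continuous_intros cp cf c1 c2)
    have "((\<lambda>z. \<phi> z *\<^sub>R f z) has_derivative
        (\<lambda>h. fst h *\<^sub>R (d1 z *\<^sub>R f z + \<phi> z *\<^sub>R g1 z) + snd h *\<^sub>R (d2 z *\<^sub>R f z + \<phi> z *\<^sub>R g2 z))) (at z)" for z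
      by (rule has_derivative_eq_rhs[OF has_derivative_scaleR[OF dp der]])
        (auto simp: algebra_simps fun_eq_iff)
    note 0 = integral_partial_derivs_compact_support[OF this, of R]
    have "(\<integral>z. d1 z *\<^sub>R f z + \<phi> z *\<^sub>R g1 z \<partial>lborel) = 0" "(\<integral>z. d2 z *\<^sub>R f z + \<phi> z *\<^sub>R g2 z \<partial>lborel) = 0"
      by (rule 0; use R in \<open>auto intro!: continuous_intros cp cf c1 c2\<close>)+
    then show ?thesis using I by (simp add: eq_neg_iff_add_eq_0)
  qed
  then show ?thesis
    using loc_int_continuous cf c1 c2 by (auto simp: weak_grad_def)
qed

section \<open>Integrals of rescaled products, and the bump profile\<close>

text \<open>Every moment of the trial functions is an integral of this kind. Fubini separates the
  variables and two dilations give the factor 1/(b c).\<close>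

lemma has_bochner_integral_scaled_product:
  fixes u w :: "real \<Rightarrow> real"
  assumes cu: "continuous_on UNIV u" and cw: "continuous_on UNIV w"
    and u0: "\<And>x. x \<notin> {0..1} \<Longrightarrow> u x = 0" and w0: "\<And>x. x \<notin> {0..1} \<Longrightarrow> w x = 0"
    and b: "b > 0" and c: "c > 0"
  shows "has_bochner_integral lborel (\<lambda>z. u (b * fst z) * w (c * snd z))
           ((\<integral>x. u x \<partial>lborel) * (\<integral>x. w x \<partial>lborel) / (b * c))"
proof -
  have K: "compact ({0..1/b} \<times> {0..1/c})" by (intro compact_Times) auto
  have I: "integrable lborel (\<lambda>z. u (b * fst z) * w (c * snd z))"
  proof (rule integrable_continuous_compact_support[OF _ K])
    show "continuous_on UNIV (\<lambda>z. u (b * fst z) * w (c * snd z))"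
      by (intro continuous_intros continuous_on_compose2[OF cu] continuous_on_compose2[OF cw]) auto
    fix z assume "z \<notin> {0..1/b} \<times> {0..1/c}"
    then have "b * fst z \<notin> {0..1} \<or> c * snd z \<notin> {0..1}"
      using b c by (cases z) (auto simp: field_simps zero_le_mult_iff)
    then show "u (b * fst z) * w (c * snd z) = 0" using u0 w0 by auto
  qed
  have U: "(\<integral>x. u (b * x) \<partial>lborel) = (\<integral>x. u x \<partial>lborel) / b"
    using lborel_integral_real_affine[of b u 0] b by simp
  have W: "(\<integral>x. w (c * x) \<partial>lborel) = (\<integral>x. w x \<partial>lborel) / c"
    using lborel_integral_real_affine[of c w 0] c by simp
  have "(\<integral>z. u (b * fst z) * w (c * snd z) \<partial>lborel) = (\<integral>x. (\<integral>y. u (b * x) * w (c * y) \<partial>lborel) \<partial>lborel)"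
    using lborel_pair.integral_fst[of "\<lambda>x y. u (b * x) * w (c * y)"] I
    by (simp add: lborel_prod case_prod_beta')
  also have "\<dots> = (\<integral>x. u x \<partial>lborel) * (\<integral>x. w x \<partial>lborel) / (b * c)"
    by (simp add: U W)
  finally show ?thesis using I by (simp add: has_bochner_integral_iff)
qed

text \<open>A continuous nonnegative function whose integral over the interval is zero vanishes at
  every point of it.\<close>

lemma integral_pos_continuous_compact_support:
  fixes u :: "real \<Rightarrow> real"
  assumes "continuous_on UNIV u" and "\<And>x. x \<notin> {0..1} \<Longrightarrow> u x = 0"
    and "\<And>x. 0 \<le> u x" and "x0 \<in> {0..1}" "u x0 \<noteq> 0"
  shows "(\<integral>x. u x \<partial>lborel) > 0"
proof (rule ccontr)
  assume "\<not> (\<integral>x. u x \<partial>lborel) > 0"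
  moreover have "(\<integral>x. u x \<partial>lborel) \<ge> 0" using assms(3) by simp
  ultimately have 0: "(\<integral>x. u x \<partial>lborel) = 0" by linarith
  have "integrable lborel u"
    using assms by (intro integrable_continuous_compact_support[of u "{0..1}"]) auto
  then have "(u has_integral 0) UNIV" using has_integral_integral_lborel 0 by metis
  moreover have "(\<lambda>x. if x \<in> {0..1} then u x else 0) = u" using assms(2) by auto
  ultimately have "(u has_integral 0) {0..1}"
    using has_integral_restrict_UNIV[of "{0..1}" u 0] by simp
  then have "u x0 = 0"
    using has_integral_0_cbox_imp_0[of 0 1 u x0] continuous_on_subset[OF assms(1)] assms(3,4) by simp
  then show False using assms by simp
qed

lemma DERIV_pos_part_power:
  "((\<lambda>x::real. max 0 x ^ Suc (Suc n)) has_real_derivative real (Suc (Suc n)) * max 0 x ^ Suc n) (at x)"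
proof -
  consider "x < 0" | "x > 0" | "x = 0" by linarith
  then show ?thesis
  proof cases
    case 1
    then have "((\<lambda>x::real. 0) has_real_derivative real (Suc (Suc n)) * max 0 x ^ Suc n) (at x)"
      by simp
    then show ?thesis
      by (rule has_field_derivative_transform_within_open[where S="{..<0}"]) (use 1 in auto)
  next
    case 2
    then have "((\<lambda>x::real. x ^ Suc (Suc n)) has_real_derivative real (Suc (Suc n)) * max 0 x ^ Suc n) (at x)"
      by (auto intro!: derivative_eq_intros simp del: power_Suc)
    then show ?thesis
      by (rule has_field_derivative_transform_within_open[where S="{0<..}"]) (use 2 in auto)
  next
    case 3
    \<comment> \<open>At the kink the exponent is at least 2, so the difference quotient is still
      dominated by a positive power of |h|.\<close>
    have "((\<lambda>h::real. max 0 h ^ Suc (Suc n) / h) \<longlongrightarrow> 0) (at 0)"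
    proof (rule Lim_null_comparison)
      show "\<forall>\<^sub>F h in at 0. norm (max 0 h ^ Suc (Suc n) / h) \<le> \<bar>h\<bar> ^ Suc n"
        by (rule eventually_at_filter[THEN iffD2], rule always_eventually)
          (auto simp: max_def mult_nonpos_nonneg)
      show "((\<lambda>h::real. \<bar>h\<bar> ^ Suc n) \<longlongrightarrow> 0) (at 0)"
        by (auto intro!: tendsto_eq_intros)
    qed
    then show ?thesis using 3 by (simp add: DERIV_def)
  qed
qed

text \<open>Witness: x^3 (1-x)^4 on [0,1], extended by zero. A bump symmetric about 1/2 would have a
  derivative odd about 1/2, and the integral of its cube would be zero; unequal exponents avoid
  this. Exponents of at least 3 make the extension C^2.\<close>

lemma asymmetric_bump_exists:
  "\<exists>f f' f'' :: real \<Rightarrow> real.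
     (\<forall>x. (f has_real_derivative f' x) (at x)) \<and> (\<forall>x. (f' has_real_derivative f'' x) (at x)) \<and>
     continuous_on UNIV f'' \<and> (\<forall>x. x \<notin> {0..1} \<longrightarrow> f x = 0 \<and> f' x = 0 \<and> f'' x = 0) \<and>
     (\<integral>x. (f x)\<^sup>2 \<partial>lborel) > 0 \<and> (\<integral>x. f x ^ 3 \<partial>lborel) > 0 \<and>
     (\<integral>x. (f' x)\<^sup>2 \<partial>lborel) > 0 \<and> (\<integral>x. f' x ^ 3 \<partial>lborel) > 0"
proof -
  define p :: "real \<Rightarrow> real" where "p x = max 0 x" for x
  define f where "f x = p x ^ 3 * p (1 - x) ^ 4" for x
  define f' where "f' x = 3 * p x ^ 2 * p (1 - x) ^ 4 - 4 * p x ^ 3 * p (1 - x) ^ 3" for x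
  define f'' where "f'' x = 6 * p x * p (1 - x) ^ 4 - 24 * p x ^ 2 * p (1 - x) ^ 3
      + 12 * p x ^ 3 * p (1 - x) ^ 2" for x
  have dp: "((\<lambda>x. p x ^ 2) has_real_derivative 2 * p x) (at x)"
    "((\<lambda>x. p x ^ 3) has_real_derivative 3 * p x ^ 2) (at x)"
    "((\<lambda>x. p x ^ 4) has_real_derivative 4 * p x ^ 3) (at x)" for x
    using DERIV_pos_part_power[of 0 x] DERIV_pos_part_power[of 1 x] DERIV_pos_part_power[of 2 x]
    by (simp_all add: p_def[abs_def] numeral_2_eq_2 numeral_3_eq_3 eval_nat_numeral)
  have d1x: "((\<lambda>x::real. 1 - x) has_real_derivative -1) (at x)" for x
    by (auto intro!: derivative_eq_intros)
  have dq: "((\<lambda>x. p (1 - x) ^ 3) has_real_derivative - 3 * p (1 - x) ^ 2) (at x)"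
    "((\<lambda>x. p (1 - x) ^ 4) has_real_derivative - 4 * p (1 - x) ^ 3) (at x)" for x
    using DERIV_chain2[where g="\<lambda>x. 1 - x" and x=x, OF dp(2) d1x]
      DERIV_chain2[where g="\<lambda>x. 1 - x" and x=x, OF dp(3) d1x]
    by simp_all
  have d1: "(f has_real_derivative f' x) (at x)" for x
    unfolding f_def[abs_def] f'_def
    by (rule DERIV_cong[OF DERIV_mult[OF dp(2) dq(2)]]) simp
  have d2: "(f' has_real_derivative f'' x) (at x)" for x
    unfolding f''_def f'_def[abs_def]
    by (rule DERIV_cong[OF DERIV_diff[OF DERIV_mult[OF DERIV_cmult[OF dp(1)] dq(2)]
            DERIV_mult[OF DERIV_cmult[OF dp(2)] dq(1)]]]) (simp add: algebra_simps)
  have cp: "continuous_on A (\<lambda>x. p (g x))" if "continuous_on A g" for A and g :: "real \<Rightarrow> real"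
    unfolding p_def using that by (intro continuous_intros)
  have c: "continuous_on UNIV f" "continuous_on UNIV f'" "continuous_on UNIV f''"
    unfolding f_def[abs_def] f'_def[abs_def] f''_def[abs_def] by (intro continuous_intros cp)+
  have z: "f x = 0 \<and> f' x = 0 \<and> f'' x = 0" if "x \<notin> {0..1}" for x
    using that by (auto simp: f_def f'_def f''_def p_def max_def)
  have nn: "0 \<le> f x" for x by (auto simp: f_def p_def)
  \<comment> \<open>Inside (0,1) the factor 3 - 7x is the only one of \<open>f'\<close> that
    vanishes, at 3/7; the sample point 1/4 avoids it.\<close>
  have half: "f (1/2) \<noteq> 0" "f' (1/4) \<noteq> 0" by (auto simp: f_def f'_def p_def power_divide)
  have i2: "(\<integral>x. (f x)\<^sup>2 \<partial>lborel) > 0" "(\<integral>x. f x ^ 3 \<partial>lborel) > 0"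
    by (rule integral_pos_continuous_compact_support[of _ "1/2"];
        use c z nn half in \<open>auto intro!: continuous_intros\<close>)+
  have i3: "(\<integral>x. (f' x)\<^sup>2 \<partial>lborel) > 0"
    by (rule integral_pos_continuous_compact_support[of _ "1/4"];
        use c z nn half in \<open>auto intro!: continuous_intros\<close>)
  \<comment> \<open>An antiderivative of $f'^3$ on $[0,1]$; it yields $\int f'^3 = 3/1616615$.\<close>
  define P :: "real \<Rightarrow> real" where "P x = 27/7 * x^7 - 54 * x^8 + 346 * x^9 - 6692/5 * x^10 + 38241/11 * x^11
      - 6384 * x^12 + 110460/13 * x^13 - 57816/7 * x^14 + 29103/5 * x^15 - 2901 * x^16
      + 16506/17 * x^17 - 196 * x^18 + 343/19 * x^19" for x
  have dP: "(P has_real_derivative (x^2 * (1-x)^3 * (3 - 7*x))^3) (at x)" for x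
  proof -
    have "(P has_real_derivative (27 * x^6 - 432 * x^7 + 3114 * x^8 - 13384 * x^9 + 38241 * x^10
      - 76608 * x^11 + 110460 * x^12 - 115632 * x^13 + 87309 * x^14 - 46416 * x^15 + 16506 * x^16
      - 3528 * x^17 + 343 * x^18)) (at x)"
      unfolding P_def[abs_def] by (rule derivative_eq_intros refl | simp)+
    moreover have "(27 * x^6 - 432 * x^7 + 3114 * x^8 - 13384 * x^9 + 38241 * x^10
      - 76608 * x^11 + 110460 * x^12 - 115632 * x^13 + 87309 * x^14 - 46416 * x^15 + 16506 * x^16
      - 3528 * x^17 + 343 * x^18) = (x^2 * (1-x)^3 * (3 - 7*x))^3"
      by algebra
    ultimately show ?thesis by simp
  qed
  have "(\<integral>x. f' x ^ 3 \<partial>lborel)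
      = (\<integral>x. (x^2 * (1-x)^3 * (3 - 7*x))^3 * indicator {0..1} x \<partial>lborel)"
  proof (rule Bochner_Integration.integral_cong[OF refl])
    fix x :: real
    have "f' x = x^2 * (1-x)^3 * (3 - 7*x)" if "x \<in> {0..1}"
    proof -
      have "p x = x" "p (1 - x) = 1 - x" using that by (auto simp: p_def)
      then have "f' x = 3 * x^2 * (1 - x)^4 - 4 * x^3 * (1 - x)^3" by (simp add: f'_def)
      then show ?thesis by algebra
    qed
    then show "f' x ^ 3 = (x^2 * (1-x)^3 * (3 - 7*x))^3 * indicator {0..1} x"
      using z[of x] by (cases "x \<in> {0..1}") auto
  qed
  also have "\<dots> = P 1 - P 0"
    by (rule integral_FTC_Icc_real) (auto intro!: dP continuous_intros)
  also have "\<dots> > 0" by (simp add: P_def)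
  finally show ?thesis using d1 d2 c(3) z i2 i3 by (intro exI[of _ f] exI[of _ f'] exI[of _ f'']) simp
qed

section \<open>The potential near density 1\<close>

text \<open>Integrating the expansion of \<open>F\<close> from 1 to 1 + r gives the quadratic and
  cubic terms with an error of fourth order. For small r the sum of these two terms is nonnegative,
  which removes the absolute value from it.\<close>

lemma Vpot_bound_near_1:
  fixes F :: "real \<Rightarrow> real"
  assumes "\<delta> > 0" and cont: "continuous_on {1-\<delta><..<1+\<delta>} F"
    and F: "\<And>s. s \<in> {1-\<delta><..<1+\<delta>} \<Longrightarrow> \<bar>F s - (- (s - 1) + k / 2 * (s - 1)\<^sup>2)\<bar> \<le> C * \<bar>s - 1\<bar> ^ 3"
  shows "\<exists>\<rho>>0. \<forall>r. \<bar>r\<bar> < \<rho> \<longrightarrow> \<bar>Vpot F (1 + r)\<bar> \<le> r\<^sup>2 / 2 - k / 6 * r ^ 3 + \<bar>C\<bar> * r ^ 4"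
\<comment> \<open>The bound \<open>\<delta>\<close> keeps the integration interval where the
  expansion holds. The other bound gives |k r| < 1, hence 1/2 - k r/6 >= 0.\<close>
proof (intro exI[of _ "min \<delta> (1 / (\<bar>k\<bar> + 1))"] conjI allI impI)
  show "min \<delta> (1 / (\<bar>k\<bar> + 1)) > 0" using assms(1) by simp
  fix r :: real assume r: "\<bar>r\<bar> < min \<delta> (1 / (\<bar>k\<bar> + 1))"
  define P where "P s = - (s - 1)\<^sup>2 / 2 + k / 6 * (s - 1) ^ 3" for s
  \<comment> \<open>Ordering the endpoints treats both signs of r at once. The sign convention in
    \<open>Vpot\<close> and P 1 = 0 then make the two differences below agree up to sign.\<close>
  define a b where "a = min 1 (1 + r)" and "b = max 1 (1 + r)"
  have ab: "a \<le> b" "{a..b} \<subseteq> {1-\<delta><..<1+\<delta>}" "b - a = \<bar>r\<bar>"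
    and near: "\<And>s. s \<in> {a..b} \<Longrightarrow> \<bar>s - 1\<bar> \<le> \<bar>r\<bar>"
    using r by (auto simp: a_def b_def)
  have dP: "(P has_real_derivative (- (s - 1) + k / 2 * (s - 1)\<^sup>2)) (at s)" for s
    unfolding P_def by (auto intro!: derivative_eq_intros simp: field_simps)
  have "F integrable_on {a..b}"
    using continuous_on_subset[OF cont ab(2)] by (rule integrable_continuous_interval)
  moreover have "((\<lambda>s. - (s - 1) + k / 2 * (s - 1)\<^sup>2) has_integral P b - P a) {a..b}"
    using ab(1) dP[THEN DERIV_subset] by (intro fundamental_theorem_of_calculus)
      (auto simp flip: has_real_derivative_iff_has_vector_derivative)
  ultimately have "((\<lambda>s. F s - (- (s - 1) + k / 2 * (s - 1)\<^sup>2)) has_integral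
      integral {a..b} F - (P b - P a)) {a..b}"
    by (intro has_integral_diff) (auto simp: has_integral_integral)
  moreover have "norm (F s - (- (s - 1) + k / 2 * (s - 1)\<^sup>2)) \<le> \<bar>C\<bar> * \<bar>r\<bar> ^ 3" if "s \<in> {a..b}" for s
  proof -
    have "\<bar>F s - (- (s - 1) + k / 2 * (s - 1)\<^sup>2)\<bar> \<le> C * \<bar>s - 1\<bar> ^ 3"
      using F that ab(2) by blast
    also have "\<dots> \<le> \<bar>C\<bar> * \<bar>r\<bar> ^ 3"
      using near[OF that] by (intro mult_mono power_mono) auto
    finally show ?thesis by simp
  qed
  ultimately have "norm (integral {a..b} F - (P b - P a)) \<le> \<bar>C\<bar> * \<bar>r\<bar> ^ 3 * measure lborel {a..b}"
    by (intro has_integral_bound_real) auto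
  then have I: "\<bar>integral {a..b} F - (P b - P a)\<bar> \<le> \<bar>C\<bar> * \<bar>r\<bar> ^ 3 * \<bar>r\<bar>"
    using ab by simp
  have "\<bar>Vpot F (1 + r) - (r\<^sup>2 / 2 - k / 6 * r ^ 3)\<bar> = \<bar>integral {a..b} F - (P b - P a)\<bar>"
    unfolding Vpot_def by (cases "r \<le> 0") (auto simp: a_def b_def P_def)
  also have "\<dots> \<le> \<bar>C\<bar> * r ^ 4"
    using I by (simp add: power4_eq_xxxx power3_eq_cube abs_mult mult.assoc)
  finally have 1: "\<bar>Vpot F (1 + r) - (r\<^sup>2 / 2 - k / 6 * r ^ 3)\<bar> \<le> \<bar>C\<bar> * r ^ 4" .
  have "\<bar>r\<bar> * (\<bar>k\<bar> + 1) < 1" using r by (simp add: field_simps)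
  then have "\<bar>k * r\<bar> \<le> 3" by (simp add: abs_mult algebra_simps)
  then have "0 \<le> r\<^sup>2 * (1 / 2 - (k * r) / 6)" by (intro mult_nonneg_nonneg) auto
  then have "0 \<le> r\<^sup>2 / 2 - k / 6 * r ^ 3" by (simp add: algebra_simps power2_eq_square power3_eq_cube)
  then show "\<bar>Vpot F (1 + r)\<bar> \<le> r\<^sup>2 / 2 - k / 6 * r ^ 3 + \<bar>C\<bar> * r ^ 4" using 1 by linarith
qed

section \<open>Energy and momentum in polar form\<close>

text \<open>The competitor is sqrt(1 + r) e^(i \<open>\<theta>\<close>). Its momentum density is -(1
  + r) \<open>t1\<close>: the part -r \<open>t1\<close> is integrable and carries the momentum,
  while -\<open>t1\<close> is the x1-derivative of -\<open>\<theta>\<close> and is not counted by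
  L.\<close>

lemma Emin_le_polar:
  fixes r \<theta> :: "real \<times> real \<Rightarrow> real"
  assumes dr: "\<And>z. (r has_derivative (\<lambda>h. fst h * r1 z + snd h * r2 z)) (at z)"
    and d\<theta>: "\<And>z. (\<theta> has_derivative (\<lambda>h. fst h * t1 z + snd h * t2 z)) (at z)"
    and c: "continuous_on UNIV r1" "continuous_on UNIV r2" "continuous_on UNIV t1" "continuous_on UNIV t2"
    and K: "compact K"
    and supp: "\<And>z. z \<notin> K \<Longrightarrow> r z = 0 \<and> r1 z = 0 \<and> r2 z = 0 \<and> t1 z = 0 \<and> t2 z = 0"
    and small: "\<And>z. \<bar>r z\<bar> \<le> 1 / 2"
    and q: "(\<integral>z. - (r z * t1 z) \<partial>lborel) = q"
    and \<kappa>: "\<forall>s\<in>{0..2}. \<kappa> s = s"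
  shows "Emin F \<kappa> q \<le> (\<integral>\<^sup>+z. ennreal (((r1 z)\<^sup>2 + (r2 z)\<^sup>2) / 2 + (1 + r z) * ((t1 z)\<^sup>2 + (t2 z)\<^sup>2)) \<partial>lborel)
     + (\<integral>\<^sup>+z. ennreal \<bar>Vpot F (1 + r z)\<bar> \<partial>lborel)"
proof -
  define \<rho> where "\<rho> z = sqrt (1 + r z)" for z
  define \<psi> where "\<psi> z = complex_of_real (\<rho> z) * cis (\<theta> z)" for z
  \<comment> \<open>A partial derivative of \<open>\<psi>\<close>, where s and t stand for the same
    partial derivatives of r and \<open>\<theta>\<close>.\<close>
  define G where "G s t z = (complex_of_real (s z / (2 * \<rho> z)) + \<i> * complex_of_real (\<rho> z * t z)) * cis (\<theta> z)"
    for s t z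
  have pos: "1 + r z > 0" for z using small[of z] by linarith
  then have \<rho>pos: "\<rho> z > 0" and \<rho>2: "(\<rho> z)\<^sup>2 = 1 + r z" for z by (auto simp: \<rho>_def less_imp_le)
  have cr: "continuous_on UNIV r" "continuous_on UNIV \<theta>"
    using dr d\<theta> by (auto intro!: has_derivative_continuous_on intro: has_derivative_at_withinI)
  have c\<rho>: "continuous_on UNIV \<rho>" unfolding \<rho>_def[abs_def] by (intro continuous_intros cr)
  have cG: "continuous_on UNIV (G s t)" if "continuous_on UNIV s" "continuous_on UNIV t" for s t
    unfolding G_def[abs_def] using that \<rho>pos
    by (intro continuous_intros continuous_on_cis c\<rho> cr) (auto simp: less_le)
  have d\<rho>: "(\<rho> has_derivative (\<lambda>h. (fst h * r1 z + snd h * r2 z) / (2 * \<rho> z))) (at z)" for z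
    unfolding \<rho>_def[abs_def] using pos[of z]
    by (auto intro!: derivative_eq_intros dr simp: divide_simps)
  have d\<psi>: "(\<psi> has_derivative (\<lambda>h. fst h *\<^sub>R G r1 t1 z + snd h *\<^sub>R G r2 t2 z)) (at z)" for z
    unfolding \<psi>_def[abs_def]
    by (rule has_derivative_eq_rhs[OF has_derivative_mult[OF has_derivative_of_real[OF d\<rho>] has_derivative_cis[OF d\<theta>]]])
      (auto simp: G_def fun_eq_iff scaleR_conv_of_real algebra_simps add_divide_distrib)
  have wg: "weak_grad \<psi> (G r1 t1) (G r2 t2)"
    by (rule weak_grad_C1[OF d\<psi>]) (intro cG c)+
  have sG: "square_int (G r1 t1)" "square_int (G r2 t2)"
    using square_int_continuous_compact_support[OF cG K] supp c by (simp_all add: G_def)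
  have cm: "cmod (\<psi> z) = \<rho> z" for z
    using \<rho>pos[of z] by (simp add: \<psi>_def norm_mult)
  \<comment> \<open>In this range the cutoff \<open>\<kappa>\<close> is the identity, so the
    quantity required to be square integrable is just r.\<close>
  have "\<rho> z \<in> {0..2}" for z
    using \<rho>pos[of z] small[of z] by (auto simp: \<rho>_def intro!: real_le_lsqrt)
  then have "(\<kappa> (cmod (\<psi> z)))\<^sup>2 - 1 = r z" for z
    using \<kappa> \<rho>2[of z] cm[of z] by simp
  moreover have "square_int r"
    by (rule square_int_continuous_compact_support[OF _ K]) (use supp cr in auto)
  ultimately have inE: "in_E \<kappa> \<psi> (G r1 t1) (G r2 t2)"
    using wg sG unfolding in_E_def by simp
  \<comment> \<open>The function -\<open>\<theta>\<close> serves as the potential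
    \<open>\<phi>\<close> in \<open>momentum_is\<close>.\<close>
  have w\<theta>: "weak_grad (\<lambda>z. - \<theta> z) (\<lambda>z. - t1 z) (\<lambda>z. - t2 z)"
  proof (rule weak_grad_C1)
    show "((\<lambda>z. - \<theta> z) has_derivative (\<lambda>h. fst h *\<^sub>R - t1 z + snd h *\<^sub>R - t2 z)) (at z)" for z
      by (rule has_derivative_eq_rhs[OF has_derivative_minus[OF d\<theta>]]) (auto simp: fun_eq_iff)
  qed (intro continuous_intros c)+
  have st: "square_int (\<lambda>z. - t1 z)" "square_int (\<lambda>z. - t2 z)"
    by (rule square_int_continuous_compact_support[OF _ K]; use supp in \<open>auto intro!: continuous_intros c\<close>)+
  have iv: "integrable lborel (\<lambda>z. - (r z * t1 z))"
    by (rule integrable_continuous_compact_support[OF _ K]) (use supp in \<open>auto intro!: continuous_intros c cr\<close>)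
  have dens: "Re (\<i> * G r1 t1 z * cnj (\<psi> z)) = - (r z * t1 z) + - t1 z" for z
  proof -
    have "cis (\<theta> z) * cnj (cis (\<theta> z)) = 1" by (simp add: cis_cnj cis_mult)
    then have "\<i> * G r1 t1 z * cnj (\<psi> z)
        = \<i> * (complex_of_real (r1 z / (2 * \<rho> z)) + \<i> * complex_of_real (\<rho> z * t1 z)) * complex_of_real (\<rho> z)"
      unfolding G_def \<psi>_def by (simp add: mult.assoc mult.left_commute)
    then have "Re (\<i> * G r1 t1 z * cnj (\<psi> z)) = Re (\<i> * (complex_of_real (r1 z / (2 * \<rho> z))
        + \<i> * complex_of_real (\<rho> z * t1 z)) * complex_of_real (\<rho> z))" by (rule arg_cong)
    also have "\<dots> = - ((\<rho> z)\<^sup>2 * t1 z)"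
      by (simp add: power2_eq_square)
    finally show ?thesis by (simp add: \<rho>2 algebra_simps)
  qed
  have mom: "momentum_is \<psi> q"
    unfolding momentum_is_def
  proof (intro exI conjI)
    show "AE z in lborel. Re (\<i> * G r1 t1 z * cnj (\<psi> z)) = - (r z * t1 z) + - t1 z"
      using dens by (intro always_eventually allI)
  qed (fact wg sG iv w\<theta> st q)+
  have cG2: "(cmod (G s t z))\<^sup>2 \<le> (s z)\<^sup>2 / 2 + (1 + r z) * (t z)\<^sup>2" for s t z
  proof -
    have "(cmod (G s t z))\<^sup>2 = (s z / (2 * \<rho> z))\<^sup>2 + (\<rho> z * t z)\<^sup>2"
      by (simp add: G_def norm_mult cmod_power2)
    also have "\<dots> = (s z)\<^sup>2 / (4 * (1 + r z)) + (1 + r z) * (t z)\<^sup>2"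
      by (simp add: power_divide power_mult_distrib \<rho>2)
    \<comment> \<open>Smallness of r gives 1 + r >= 1/2, so the denominator is at least 2.\<close>
    also have "(s z)\<^sup>2 / (4 * (1 + r z)) \<le> (s z)\<^sup>2 / 2"
      using small[of z] pos[of z] by (intro divide_left_mono) auto
    finally show ?thesis by simp
  qed
  have "Emin F \<kappa> q \<le> (\<integral>\<^sup>+z. ennreal ((cmod (G r1 t1 z))\<^sup>2 + (cmod (G r2 t2 z))\<^sup>2) \<partial>lborel)
        + (\<integral>\<^sup>+z. ennreal \<bar>Vpot F ((cmod (\<psi> z))\<^sup>2)\<bar> \<partial>lborel)"
    unfolding Emin_def by (rule Inf_lower) (use inE mom in blast)
  also have "\<dots> \<le> (\<integral>\<^sup>+z. ennreal (((r1 z)\<^sup>2 + (r2 z)\<^sup>2) / 2 + (1 + r z) * ((t1 z)\<^sup>2 + (t2 z)\<^sup>2)) \<partial>lborel)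
     + (\<integral>\<^sup>+z. ennreal \<bar>Vpot F (1 + r z)\<bar> \<partial>lborel)"
  proof (rule add_mono; intro nn_integral_mono ennreal_leI)
    fix z
    show "(cmod (G r1 t1 z))\<^sup>2 + (cmod (G r2 t2 z))\<^sup>2
        \<le> ((r1 z)\<^sup>2 + (r2 z)\<^sup>2) / 2 + (1 + r z) * ((t1 z)\<^sup>2 + (t2 z)\<^sup>2)"
      using cG2[of r1 t1 z] cG2[of r2 t2 z] by (simp add: algebra_simps add_divide_distrib)
  qed (simp add: cm \<rho>2)
  finally show ?thesis .
qed

section \<open>The rescaled trial functions and the strict inequality\<close>

lemma has_derivative_scaled_product:
  fixes u w :: "real \<Rightarrow> real"
  assumes "\<And>x. (u has_real_derivative u' x) (at x)" and "\<And>x. (w has_real_derivative w' x) (at x)"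
  shows "((\<lambda>z. A * (u (b * fst z) * w (c * snd z))) has_derivative
     (\<lambda>h. fst h * (A * b * (u' (b * fst z) * w (c * snd z))) +
          snd h * (A * c * (u (b * fst z) * w' (c * snd z))))) (at z)"
proof -
  have "((\<lambda>z. u (b * fst z)) has_derivative (\<lambda>h. u' (b * fst z) * (b * fst h))) (at z)"
    by (rule has_derivative_compose[OF _ assms(1)[unfolded has_field_derivative_def]])
      (auto intro!: derivative_eq_intros)
  moreover have "((\<lambda>z. w (c * snd z)) has_derivative (\<lambda>h. w' (c * snd z) * (c * snd h))) (at z)"
    by (rule has_derivative_compose[OF _ assms(2)[unfolded has_field_derivative_def]])
      (auto intro!: derivative_eq_intros)
  ultimately show ?thesis
    by (auto intro!: derivative_eq_intros simp: algebra_simps)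
qed

theorem theorem4p15:
  fixes F :: "real \<Rightarrow> real" and \<kappa> :: "real \<Rightarrow> real" and q :: real
  assumes chi_smooth: "\<forall>n x. ((deriv ^^ n) \<kappa>) differentiable (at x)"
    and chi_odd: "\<forall>s. \<kappa> (- s) = - \<kappa> s"
    and chi_id: "\<forall>s\<in>{0..2}. \<kappa> s = s"
    and chi_deriv: "\<forall>s. 0 \<le> deriv \<kappa> s \<and> deriv \<kappa> s \<le> 1"
    and chi_const: "\<forall>s\<ge>4. \<kappa> s = 3"
    and A1_cont: "continuous_on {0..} F"
    and F1: "F 1 = 0"
    and A4_C2: "\<exists>\<delta>>0. \<exists>F1 F2. (\<forall>s\<in>{1-\<delta><..<1+\<delta>}.
                  (F has_real_derivative F1 s) (at s) \<and> (F1 has_real_derivative F2 s) (at s)) \<and>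
                  continuous_on {1-\<delta><..<1+\<delta>} F2 \<and> F1 1 = -1 \<and> F2 1 \<noteq> 3 \<and>
                  (\<exists>C. \<forall>s\<in>{1-\<delta><..<1+\<delta>}.
                     \<bar>F s - (- (s - 1) + F2 1 / 2 * (s - 1)\<^sup>2)\<bar> \<le> C * \<bar>s - 1\<bar> ^ 3)"
    and A2: "\<exists>C>0. \<exists>p0::real. \<forall>s\<ge>0. \<bar>F s\<bar> \<le> C * (1 + s powr p0)"
    and q_pos: "q > 0"
  shows "Emin F \<kappa> q < ennreal (sqrt 2 * q)"
proof -
  obtain \<delta> F' F'' C where \<delta>: "\<delta> > 0"
    and dF: "\<forall>s\<in>{1-\<delta><..<1+\<delta>}. (F has_real_derivative F' s) (at s) \<and> (F' has_real_derivative F'' s) (at s)"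
    and k3: "F'' 1 \<noteq> 3"
    and C: "\<forall>s\<in>{1-\<delta><..<1+\<delta>}. \<bar>F s - (- (s - 1) + F'' 1 / 2 * (s - 1)\<^sup>2)\<bar> \<le> C * \<bar>s - 1\<bar> ^ 3"
    using A4_C2 by blast
  define k where "k = F'' 1"
  \<comment> \<open>The total coefficient of the cubic term: 1/2 comes from (1 + r)
    \<open>t1\<close>^2 with \<open>t1\<close>^2 = r^2/2, and -k/6 from the potential. It vanishes
    exactly when k = 3.\<close>
  define e where "e = 1 / 2 - k / 6"
  have e: "e \<noteq> 0" using k3 by (simp add: e_def k_def)
  have "continuous_on {1-\<delta><..<1+\<delta>} F"
    using dF by (auto intro!: continuous_at_imp_continuous_on DERIV_isCont)
  from Vpot_bound_near_1[OF \<delta> this, of k C] C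
  obtain \<rho> where \<rho>: "\<rho> > 0"
    and V: "\<And>r. \<bar>r\<bar> < \<rho> \<Longrightarrow> \<bar>Vpot F (1 + r)\<bar> \<le> r\<^sup>2 / 2 - k / 6 * r ^ 3 + \<bar>C\<bar> * r ^ 4"
    by (auto simp: k_def)
  obtain f f' f'' :: "real \<Rightarrow> real"
    where d: "\<And>x. (f has_real_derivative f' x) (at x)" "\<And>x. (f' has_real_derivative f'' x) (at x)"
    and c2: "continuous_on UNIV f''"
    and z: "\<And>x. x \<notin> {0..1} \<Longrightarrow> f x = 0 \<and> f' x = 0 \<and> f'' x = 0"
    and I: "(\<integral>x. (f x)\<^sup>2 \<partial>lborel) > 0" "(\<integral>x. f x ^ 3 \<partial>lborel) > 0"
      "(\<integral>x. (f' x)\<^sup>2 \<partial>lborel) > 0" "(\<integral>x. f' x ^ 3 \<partial>lborel) > 0"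
    using asymmetric_bump_exists by blast
  have c01: "continuous_on UNIV f" "continuous_on UNIV f'"
    using d by (auto intro!: continuous_at_imp_continuous_on DERIV_isCont)
  note cont = c01 c2
  define G2 G3 G4 J2 J3 J4 H2 where "G2 = (\<integral>x. (f x)\<^sup>2 \<partial>lborel)" and "G3 = (\<integral>x. f x ^ 3 \<partial>lborel)"
    and "G4 = (\<integral>x. f x ^ 4 \<partial>lborel)" and "J2 = (\<integral>x. (f' x)\<^sup>2 \<partial>lborel)"
    and "J3 = (\<integral>x. f' x ^ 3 \<partial>lborel)" and "J4 = (\<integral>x. f' x ^ 4 \<partial>lborel)"
    and "H2 = (\<integral>x. (f'' x)\<^sup>2 \<partial>lborel)"
  note IJ = G2_def G3_def G4_def J2_def J3_def J4_def H2_def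
  have P: "G2 > 0" "G3 > 0" "J2 > 0" "J3 > 0" using I by (auto simp: IJ)
  \<comment> \<open>The integral of r^2 will be J2 G2 / m; this choice makes it sqrt 2 * q.\<close>
  define m where "m = J2 * G2 / (sqrt 2 * q)"
  have m: "m > 0" using P q_pos by (simp add: m_def)
  obtain B where B: "B > 0" "\<And>x y. \<bar>f' x * f y\<bar> \<le> B"
  proof -
    have "compact (f' ` {0..1})" "compact (f ` {0..1})"
      by (intro compact_continuous_image continuous_on_subset[OF cont(1)] continuous_on_subset[OF cont(2)]; simp)+
    then obtain B1 B2 where b: "B1 > 0" "\<forall>x\<in>f' ` {0..1}. norm x \<le> B1" "B2 > 0" "\<forall>x\<in>f ` {0..1}. norm x \<le> B2"
      by (meson bounded_pos compact_imp_bounded)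
    have "\<bar>f' x\<bar> \<le> B1" "\<bar>f x\<bar> \<le> B2" for x
      using b z[of x] by (cases "x \<in> {0..1}"; force)+
    then have "\<bar>f' x * f y\<bar> \<le> B1 * B2" for x y
      unfolding abs_mult using b by (intro mult_mono) auto
    then show thesis using that[of "B1 * B2"] b by simp
  qed
  \<comment> \<open>The surplus of the energy bound over sqrt 2 * q, divided by t^3. The terms come,
    in order, from r^3, \<open>r1\<close>^2, \<open>r2\<close>^2, \<open>t2\<close>^2 and r^4; only
    the first survives as t tends to 0, and it is negative.\<close>
  define L where "L t = - \<bar>e\<bar> * J3 * G3 / m + t * (H2 * G2 / m / 2) + t ^ 5 * (m * J2\<^sup>2 / 2)
      + t * (3 / 4 * m * G2 * J2) + t ^ 3 * (\<bar>C\<bar> * J4 * G4 / m)" for t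
  have "(L \<longlongrightarrow> L 0) (at_right 0)"
    unfolding L_def using m by (auto intro!: tendsto_eq_intros)
  moreover have "L 0 < 0" using e P m by (simp add: L_def)
  ultimately have ev1: "\<forall>\<^sub>F t in at_right 0. L t < 0" by (rule order_tendstoD)
  \<comment> \<open>The quantity t^3 B bounds |r|. It must lie within the range of the potential
    estimate and within the 1/2 required for the polar form.\<close>
  have "((\<lambda>t::real. t ^ 3 * B) \<longlongrightarrow> 0) (at_right 0)" by (auto intro!: tendsto_eq_intros)
  then have ev2: "\<forall>\<^sub>F t in at_right 0. t ^ 3 * B < min \<rho> (1 / 2)"
    by (rule order_tendstoD) (use \<rho> in auto)
  have "\<forall>\<^sub>F t::real in at_right 0. t > 0" by (simp add: eventually_at_right_less)
  with ev1 ev2 have "\<forall>\<^sub>F t in at_right 0. L t < 0 \<and> t ^ 3 * B < min \<rho> (1 / 2) \<and> t > 0"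
    by eventually_elim simp
  then obtain t :: real where t: "L t < 0" "t ^ 3 * B < min \<rho> (1 / 2)" "t > 0"
    using eventually_happens'[OF trivial_limit_at_right_real] by blast
  \<comment> \<open>The sign of \<open>a\<close> makes e times the integral of r^3 negative.
    Relative to the integral of r^2, the cubic term weighs t^3, the x1-gradient of r weighs b^2 =
    t^4, and the x2-gradient of the phase weighs about (c/b)^2, again of order t^4.\<close>
  define a b c where "a = - sgn e * t ^ 3" and "b = t\<^sup>2" and "c = m * t ^ 4"
  have abc: "b > 0" "c > 0" "\<bar>a\<bar> = t ^ 3" "a\<^sup>2 = t ^ 6"
    using t m e by (auto simp: a_def b_def c_def abs_mult sgn_if power_mult_distrib simp flip: power_mult)
  define r where "r z = a * (f' (b * fst z) * f (c * snd z))" for z :: "real \<times> real"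
  define r1 where "r1 z = a * b * (f'' (b * fst z) * f (c * snd z))" for z :: "real \<times> real"
  define r2 where "r2 z = a * c * (f' (b * fst z) * f' (c * snd z))" for z :: "real \<times> real"
  \<comment> \<open>Since r is a multiple of the x1-derivative of the profile of
    \<open>\<theta>\<close>, this amplitude gives \<open>t1\<close> = -r / sqrt 2 exactly.\<close>
  define A where "A = - (a / (b * sqrt 2))"
  define \<theta> where "\<theta> z = A * (f (b * fst z) * f (c * snd z))" for z :: "real \<times> real"
  define t1 where "t1 z = A * b * (f' (b * fst z) * f (c * snd z))" for z :: "real \<times> real"
  define t2 where "t2 z = A * c * (f (b * fst z) * f' (c * snd z))" for z :: "real \<times> real"
  have Ab: "A * b = - (a / sqrt 2)" using abc by (simp add: A_def)
  then have t1r: "t1 z = - (r z / sqrt 2)" for z by (simp add: t1_def r_def)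
  then have t1sq: "(t1 z)\<^sup>2 = (r z)\<^sup>2 / 2" for z by (simp add: power_divide)
  have small: "\<bar>r z\<bar> < \<rho>" "\<bar>r z\<bar> \<le> 1 / 2" for z
  proof -
    have "\<bar>r z\<bar> \<le> t ^ 3 * B"
      unfolding r_def abs_mult[of a] abc(3) using B t by (intro mult_left_mono) auto
    then show "\<bar>r z\<bar> < \<rho>" "\<bar>r z\<bar> \<le> 1 / 2" using t(2) by auto
  qed
  have integral_prod: "has_bochner_integral lborel (\<lambda>z. (X * (u (b * fst z) * w (c * snd z))) ^ n)
      (X ^ n * ((\<integral>x. u x ^ n \<partial>lborel) * (\<integral>x. w x ^ n \<partial>lborel) / (b * c)))"
    if "continuous_on UNIV u" "continuous_on UNIV w" "\<And>x. x \<notin> {0..1} \<Longrightarrow> u x = 0"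
      "\<And>x. x \<notin> {0..1} \<Longrightarrow> w x = 0" "n > 0" for u w :: "real \<Rightarrow> real" and X n
    unfolding power_mult_distrib
    by (intro has_bochner_integral_mult_right has_bochner_integral_scaled_product)
      (use that abc in \<open>auto intro!: continuous_intros\<close>)
  \<comment> \<open>The same power of t as in \<open>a\<close>^2, so the second moment of r does not
    depend on t.\<close>
  have bc: "b * c = m * t ^ 6" by (simp add: b_def c_def flip: power_add)
  have Jr2: "has_bochner_integral lborel (\<lambda>z. (r z)\<^sup>2) (sqrt 2 * q)"
  proof -
    have "a\<^sup>2 * (J2 * G2 / (b * c)) = sqrt 2 * q"
      unfolding abc(4) bc using t P q_pos by (simp add: m_def)
    then show ?thesis
      using integral_prod[of f' f 2 a] cont z unfolding r_def IJ by simp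
  qed
  have Jr3: "has_bochner_integral lborel (\<lambda>z. r z ^ 3) (- sgn e * t ^ 3 * (J3 * G3 / m))"
  proof -
    have "a ^ 3 * (J3 * G3 / (b * c)) = - sgn e * t ^ 3 * (J3 * G3 / m)"
      unfolding bc a_def using t e m by (auto simp: field_simps sgn_if simp flip: power_mult power_add)
    then show ?thesis
      using integral_prod[of f' f 3 a] cont z unfolding r_def IJ by simp
  qed
  have Jr4: "has_bochner_integral lborel (\<lambda>z. r z ^ 4) (t ^ 6 * (J4 * G4 / m))"
  proof -
    have "a ^ 4 * (J4 * G4 / (b * c)) = t ^ 6 * (J4 * G4 / m)"
      unfolding bc a_def using t e m by (auto simp: field_simps sgn_if simp flip: power_mult power_add)
    then show ?thesis
      using integral_prod[of f' f 4 a] cont z unfolding r_def IJ by simp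
  qed
  have Jr1: "has_bochner_integral lborel (\<lambda>z. (r1 z)\<^sup>2) (t ^ 4 * (H2 * G2 / m))"
  proof -
    have "(a * b)\<^sup>2 * (H2 * G2 / (b * c)) = t ^ 4 * (H2 * G2 / m)"
      unfolding bc power_mult_distrib abc(4) unfolding b_def using t m
      by (simp add: field_simps flip: power_mult power_add)
    then show ?thesis
      using integral_prod[of f'' f 2 "a * b"] cont z unfolding r1_def IJ by simp
  qed
  have Jr2': "has_bochner_integral lborel (\<lambda>z. (r2 z)\<^sup>2) (t ^ 8 * (m * J2\<^sup>2))"
  proof -
    have "(a * c)\<^sup>2 * (J2 * J2 / (b * c)) = t ^ 8 * (m * J2\<^sup>2)"
      unfolding bc power_mult_distrib abc(4) unfolding c_def using t m
      by (simp add: field_simps power_mult_distrib power2_eq_square flip: power_mult power_add)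
    then show ?thesis
      using integral_prod[of f' f' 2 "a * c"] cont z unfolding r2_def IJ by simp
  qed
  have Jt2: "has_bochner_integral lborel (\<lambda>z. (t2 z)\<^sup>2) (t ^ 4 * (m * G2 * J2 / 2))"
  proof -
    have "(A * c)\<^sup>2 * (G2 * J2 / (b * c)) = t ^ 4 * (m * G2 * J2 / 2)"
      unfolding bc A_def power_mult_distrib power2_minus power_divide abc(4) unfolding b_def c_def using t m
      by (simp add: field_simps power_mult_distrib power2_eq_square[of m] flip: power_mult power_add)
    moreover have "has_bochner_integral lborel (\<lambda>z. (t2 z)\<^sup>2) ((A * c)\<^sup>2 * (G2 * J2 / (b * c)))"
      using integral_prod[of f f' 2 "A * c"] cont z unfolding t2_def IJ by simp
    ultimately show ?thesis by (simp only:)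
  qed
  define K where "K = {0..1/b} \<times> {0..1/c}"
  have K: "compact K" unfolding K_def by (intro compact_Times) auto
  have supp: "r z = 0 \<and> r1 z = 0 \<and> r2 z = 0 \<and> t1 z = 0 \<and> t2 z = 0" if "z \<notin> K" for z
  proof -
    have "b * fst z \<notin> {0..1} \<or> c * snd z \<notin> {0..1}"
      using that abc unfolding K_def by (cases z) (auto simp: field_simps zero_le_mult_iff)
    then show ?thesis using z unfolding r_def r1_def r2_def t1_def t2_def by auto
  qed
  have cprod: "continuous_on UNIV (\<lambda>z. X * (u (b * fst z) * w (c * snd z)))"
    if "continuous_on UNIV u" "continuous_on UNIV w" for u w :: "real \<Rightarrow> real" and X
    by (intro continuous_intros continuous_on_compose2[OF that(1)] continuous_on_compose2[OF that(2)]) auto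
  \<comment> \<open>The relation between \<open>t1\<close> and r turns the momentum into the second
    moment of r over sqrt 2, so the constraint holds exactly for each t.\<close>
  have Qq: "(\<integral>z. - (r z * t1 z) \<partial>lborel) = q"
  proof -
    have "(\<integral>z. - (r z * t1 z) \<partial>lborel) = (\<integral>z. (r z)\<^sup>2 / sqrt 2 \<partial>lborel)"
      by (simp add: t1r power2_eq_square)
    also have "\<dots> = q" using has_bochner_integral_integral_eq[OF Jr2] by simp
    finally show ?thesis .
  qed
  have "Emin F \<kappa> q \<le> (\<integral>\<^sup>+z. ennreal (((r1 z)\<^sup>2 + (r2 z)\<^sup>2) / 2 + (1 + r z) * ((t1 z)\<^sup>2 + (t2 z)\<^sup>2)) \<partial>lborel)
     + (\<integral>\<^sup>+z. ennreal \<bar>Vpot F (1 + r z)\<bar> \<partial>lborel)"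
  proof (rule Emin_le_polar[where \<theta>=\<theta> and K=K])
    show "(r has_derivative (\<lambda>h. fst h * r1 z + snd h * r2 z)) (at z)" for z
      unfolding r_def[abs_def] r1_def r2_def by (rule has_derivative_scaled_product) (rule d)+
    show "(\<theta> has_derivative (\<lambda>h. fst h * t1 z + snd h * t2 z)) (at z)" for z
      unfolding \<theta>_def[abs_def] t1_def t2_def by (rule has_derivative_scaled_product) (rule d)+
    show "continuous_on UNIV r1" "continuous_on UNIV r2" "continuous_on UNIV t1" "continuous_on UNIV t2"
      unfolding r1_def[abs_def] r2_def[abs_def] t1_def[abs_def] t2_def[abs_def] by (intro cprod cont)+
  qed (use K supp small Qq chi_id in auto)
  \<comment> \<open>The \<open>t1\<close> part becomes (1 + r) r^2/2 with no loss, which keeps its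
    cubic term; for the \<open>t2\<close> part the crude bound 1 + r <= 3/2 suffices.\<close>
  also have "\<dots> \<le> (\<integral>\<^sup>+z. ennreal ((r1 z)\<^sup>2 / 2 + (r2 z)\<^sup>2 / 2 + (r z)\<^sup>2 / 2 + r z ^ 3 / 2 + 3 / 2 * (t2 z)\<^sup>2) \<partial>lborel)
     + (\<integral>\<^sup>+z. ennreal ((r z)\<^sup>2 / 2 - k / 6 * r z ^ 3 + \<bar>C\<bar> * r z ^ 4) \<partial>lborel)"
  proof (rule add_mono; intro nn_integral_mono ennreal_leI V small)
    fix z
    have "r z * (t2 z)\<^sup>2 \<le> 1 / 2 * (t2 z)\<^sup>2"
      using small(2)[of z] by (intro mult_right_mono) auto
    then show "((r1 z)\<^sup>2 + (r2 z)\<^sup>2) / 2 + (1 + r z) * ((t1 z)\<^sup>2 + (t2 z)\<^sup>2)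
        \<le> (r1 z)\<^sup>2 / 2 + (r2 z)\<^sup>2 / 2 + (r z)\<^sup>2 / 2 + r z ^ 3 / 2 + 3 / 2 * (t2 z)\<^sup>2"
      unfolding t1sq unfolding power2_eq_square power3_eq_cube by (simp add: field_simps)
  qed
  also have "\<dots> = ennreal ((t ^ 4 * (H2 * G2 / m) / 2 + t ^ 8 * (m * J2\<^sup>2) / 2 + sqrt 2 * q / 2
        + - sgn e * t ^ 3 * (J3 * G3 / m) / 2 + 3 / 2 * (t ^ 4 * (m * G2 * J2 / 2)))
      + (sqrt 2 * q / 2 - k / 6 * (- sgn e * t ^ 3 * (J3 * G3 / m)) + \<bar>C\<bar> * (t ^ 6 * (J4 * G4 / m))))"
    (is "?l1 + ?l2 = ennreal (?s1 + ?s2)")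
  proof -
    have h1: "has_bochner_integral lborel (\<lambda>z. (r1 z)\<^sup>2 / 2 + (r2 z)\<^sup>2 / 2 + (r z)\<^sup>2 / 2 + r z ^ 3 / 2 + 3 / 2 * (t2 z)\<^sup>2) ?s1"
      by (intro has_bochner_integral_add has_bochner_integral_divide has_bochner_integral_mult_right Jr1 Jr2 Jr3 Jr2' Jt2)
    have h2: "has_bochner_integral lborel (\<lambda>z. (r z)\<^sup>2 / 2 - k / 6 * r z ^ 3 + \<bar>C\<bar> * r z ^ 4) ?s2"
      by (intro has_bochner_integral_add has_bochner_integral_diff has_bochner_integral_divide has_bochner_integral_mult_right Jr2 Jr3 Jr4)
    \<comment> \<open>Passing from the nonnegative integral to the signed one needs nonnegative
      integrands. The cubic term has no fixed sign, but r^2/2 + r^3/2 = (1 + r) r^2/2 is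
      nonnegative.\<close>
    have n1: "0 \<le> (r1 z)\<^sup>2 / 2 + (r2 z)\<^sup>2 / 2 + (r z)\<^sup>2 / 2 + r z ^ 3 / 2 + 3 / 2 * (t2 z)\<^sup>2" for z
    proof -
      have "0 \<le> (1 + r z) * (r z)\<^sup>2" using small(2)[of z] by (intro mult_nonneg_nonneg) auto
      then have "0 \<le> (r z)\<^sup>2 / 2 + r z ^ 3 / 2" by (simp add: algebra_simps power2_eq_square power3_eq_cube)
      then show ?thesis using zero_le_power2[of "r1 z"] zero_le_power2[of "r2 z"] zero_le_power2[of "t2 z"] by linarith
    qed
    have n2: "0 \<le> (r z)\<^sup>2 / 2 - k / 6 * r z ^ 3 + \<bar>C\<bar> * r z ^ 4" for z
      using V[OF small(1)[of z]] by linarith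
    have "?l1 = ennreal ?s1"
      using h1 n1 by (subst nn_integral_eq_integral) (auto simp: has_bochner_integral_iff)
    moreover have "?l2 = ennreal ?s2"
      using h2 n2 by (subst nn_integral_eq_integral) (auto simp: has_bochner_integral_iff)
    moreover have "0 \<le> ?s1" using n1 unfolding has_bochner_integral_integral_eq[OF h1, symmetric] by (rule Bochner_Integration.integral_nonneg)
    moreover have "0 \<le> ?s2" using n2 unfolding has_bochner_integral_integral_eq[OF h2, symmetric] by (rule Bochner_Integration.integral_nonneg)
    ultimately show ?thesis by (simp only: ennreal_plus)
  qed
  \<comment> \<open>Kinetic and potential energy each contribute half of sqrt 2 * q, and their cubic
    coefficients add up to \<open>e\<close>. Every other term contains a factor t^3 that can be
    pulled out.\<close>
  also have "?s1 + ?s2 = sqrt 2 * q + t ^ 3 * L t"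
  proof -
    have "e * sgn e = \<bar>e\<bar>" by (simp add: abs_sgn)
    then have "t ^ 3 * (\<bar>e\<bar> * (J3 * G3 / m)) = t ^ 3 * ((1 / 2 - k / 6) * sgn e * (J3 * G3 / m))"
      by (simp add: e_def)
    moreover have "t ^ 8 = t ^ 3 * t ^ 5" "t ^ 6 = t ^ 3 * t ^ 3" "t ^ 4 = t ^ 3 * t"
      by (simp_all flip: power_add power_Suc2)
    ultimately show ?thesis unfolding L_def by (simp add: algebra_simps)
  qed
  also have "ennreal \<dots> < ennreal (sqrt 2 * q)"
    using t q_pos by (intro ennreal_lessI) (auto simp: mult_pos_neg)
  finally show ?thesis .
qed

end
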